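(* Let $p\in(0,1)$ and let $(\mathbb{G}_t)_{t\ge 1}$ be the preferential attachment random graph process with edge steps with parameter $p$. Let $f:\mathbb{N}\to\mathbb{N}$ be any function such that $f(t)\to\infty$ as $t\to\infty$ (arbitrarily slowly). Then, with high probability, \[ \omega(\mathbb{G}_{2t})=\Omega\left(t^{\frac{1-p}{2-p}}\Big(\log^{\frac{1}{2-p}}(t)\,f(t)\Big)^{-1}\right); \] that is, there exists a constant $c>0$ such that \[ \lim_{t\to\infty}\mathbb{P}\left(\omega(\mathbb{G}_{2t})\ \ge\ c\,\frac{t^{\frac{1-p}{2-p}}}{(\log t)^{\frac{1}{2-p}}\,f(t)}\right)=1 . \]
   Context: Model. Fix $p\in(0,1)$. The random (multi)graph process $(\mathbb{G}_t)_{t\ge1}$ is defined as follows. $\mathbb{G}_1$ consists of a single vertex with one self-loop attached to it. At each subsequent discrete time step, given the current graph $\mathbb{G}_t$ and independently of the past choices of operation, the graph $\mathbb{G}_{t+1}$ is obtained by performing one of the following operations: (i) (vertex step) with probability $p$, a new vertex is added and connected by one edge to exactly one existing vertex $u$ of $\mathbb{G}_t$, chosen with probability $\deg(u,t)/\sum_{w\in\mathbb{G}_t}\deg(w,t)$; (ii) (edge step) with probability $1-p$, one edge is added between two existing vertices of $\mathbb{G}_t$, which are selected independently of each other, each vertex $u$ being selected with probability $\deg(u,t)/\sum_{w\in\mathbb{G}_t}\deg(w,t)$. Loops are allowed (if the same vertex is selected twice), and a new edge may be added between vertices that already share an edge. Here $\deg(u,t)$ is the degree of $u$ in $\mathbb{G}_t$;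 a self-loop contributes $2$ to the degree and multiple edges are counted with multiplicity, so that $\sum_{w\in\mathbb{G}_t}\deg(w,t)=2t$. Notation. $\mathbb{N}=\{1,2,\dots\}$; $\log$ is the natural logarithm and $\log^{\alpha}(x)=(\log x)^{\alpha}$. The clique number $\omega(\mathbb{G})$ of a graph $\mathbb{G}$ is the number of vertices in a largest complete subgraph of $\mathbb{G}$, i.e. the largest size of a set of vertices in which any two distinct vertices are joined by at least one edge. "With high probability" means with probability tending to $1$ as $t\to\infty$. *)

theory Defs
  imports "HOL-Probability.Probability" "HOL-Library.Uprod"
begin

text \<open>
  Finite undirected multigraphs with loops. The vertices are numbered in order of arrival, so the
  vertex set is an initial segment of the natural numbers. The multiplicity of an unordered pair
  in the multiset of edges is the number of parallel edges, and \<open>Upair u u\<close> is a loop at \<open>u\<close>.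
\<close>

datatype mgraph = MGraph (nverts: nat) (edges: "nat uprod multiset")

definition verts :: "mgraph \<Rightarrow> nat set" where
  "verts G = {..<nverts G}"

text \<open>The second summand makes every loop contribute 2.\<close>

definition deg :: "mgraph \<Rightarrow> nat \<Rightarrow> nat" where
  "deg G u = size {#e \<in># edges G. u \<in> set_uprod e#} + count (edges G) (Upair u u)"

definition is_clique :: "mgraph \<Rightarrow> nat set \<Rightarrow> bool" where
  "is_clique G S \<longleftrightarrow> S \<subseteq> verts G \<and> (\<forall>u\<in>S. \<forall>v\<in>S. u \<noteq> v \<longrightarrow> Upair u v \<in># edges G)"

definition clique_number :: "mgraph \<Rightarrow> nat" where
  "clique_number G = Max {card S |S. is_clique G S}"

definition add_vertex :: "mgraph \<Rightarrow> mgraph" where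
  "add_vertex G = MGraph (Suc (nverts G)) (edges G)"

definition add_edge :: "nat \<Rightarrow> nat \<Rightarrow> mgraph \<Rightarrow> mgraph" where
  "add_edge u v G = MGraph (nverts G) (add_mset (Upair u v) (edges G))"

text \<open>
  For a graph without edges the weights do not sum to 1 and \<open>pick_vertex\<close> is unspecified. This
  never happens in the process below, see \<open>pa_graph_deg_sum\<close> and \<open>pmf_pick_vertex\<close>.
\<close>

definition pick_vertex :: "mgraph \<Rightarrow> nat pmf" where
  "pick_vertex G = embed_pmf (\<lambda>u. if u \<in> verts G
     then real (deg G u) / real (\<Sum>w\<in>verts G. deg G w) else 0)"

text \<open>The new vertex has number \<open>nverts G\<close>; its neighbour is chosen in the old graph.\<close>

definition vertex_step :: "mgraph \<Rightarrow> mgraph pmf" where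
  "vertex_step G = map_pmf (\<lambda>u. add_edge (nverts G) u (add_vertex G)) (pick_vertex G)"

definition edge_step :: "mgraph \<Rightarrow> mgraph pmf" where
  "edge_step G = map_pmf (\<lambda>(u, v). add_edge u v G) (pair_pmf (pick_vertex G) (pick_vertex G))"

definition pa_step :: "real \<Rightarrow> mgraph \<Rightarrow> mgraph pmf" where
  "pa_step p G = bind_pmf (bernoulli_pmf p) (\<lambda>b. if b then vertex_step G else edge_step G)"

definition loop_graph :: mgraph where
  "loop_graph = MGraph 1 {#Upair 0 0#}"

text \<open>
  The law of the random graph at time \<open>t \<ge> 1\<close>. The process is the Markov chain with transition
  kernel \<open>pa_step p\<close> started from \<open>loop_graph\<close> at time 1; the value at \<open>t = 0\<close> is irrelevant.
\<close>

definition pa_graph :: "real \<Rightarrow> nat \<Rightarrow> mgraph pmf" where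
  "pa_graph p t = ((\<lambda>\<mu>. bind_pmf \<mu> (pa_step p)) ^^ (t - 1)) (return_pmf loop_graph)"

lemma pa_graph_1: "pa_graph p 1 = return_pmf loop_graph"
  by (simp add: pa_graph_def)

lemma pa_graph_Suc: "t \<ge> 1 \<Longrightarrow> pa_graph p (Suc t) = bind_pmf (pa_graph p t) (pa_step p)"
  by (cases t) (auto simp: pa_graph_def)

lemma pmf_pick_vertex:
  assumes "(\<Sum>w\<in>verts G. deg G w) > 0"
  shows "pmf (pick_vertex G) u =
    (if u \<in> verts G then real (deg G u) / real (\<Sum>w\<in>verts G. deg G w) else 0)"
  unfolding pick_vertex_def
proof (rule pmf_embed_pmf)
  let ?d = "\<Sum>w\<in>verts G. deg G w"
  have fin: "finite (verts G)" by (simp add: verts_def)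
  have "(\<integral>\<^sup>+ x. ennreal (if x \<in> verts G then real (deg G x) / real ?d else 0)
          \<partial>count_space UNIV) = (\<Sum>x\<in>verts G. ennreal (real (deg G x) / real ?d))"
    by (subst nn_integral_count_space'[OF fin]) auto
  also have "\<dots> = ennreal (\<Sum>x\<in>verts G. real (deg G x) / real ?d)"
    by (rule sum_ennreal) (simp del: of_nat_sum)
  also have "(\<Sum>x\<in>verts G. real (deg G x) / real ?d) = 1"
    using assms by (simp flip: sum_divide_distrib of_nat_sum)
  finally show "(\<integral>\<^sup>+ x. ennreal (if x \<in> verts G then real (deg G x) / real ?d else 0)
          \<partial>count_space UNIV) = 1" by simp
qed (simp flip: of_nat_sum)

lemma set_pick_vertex:
  assumes "(\<Sum>w\<in>verts G. deg G w) > 0"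
  shows "set_pmf (pick_vertex G) \<subseteq> verts G"
  using pmf_pick_vertex[OF assms] by (auto simp: set_pmf_eq split: if_splits)

lemma deg_add_edge:
  "deg (add_edge u v G) w = deg G w + (if w = u then 1 else 0) + (if w = v then 1 else 0)"
  by (auto simp: deg_def add_edge_def)

lemma deg_sum_add_edge:
  assumes "u \<in> verts G" "v \<in> verts G"
  shows "(\<Sum>w\<in>verts (add_edge u v G). deg (add_edge u v G) w) = (\<Sum>w\<in>verts G. deg G w) + 2"
proof -
  have "verts (add_edge u v G) = verts G" by (simp add: verts_def add_edge_def)
  moreover have "finite (verts G)" by (simp add: verts_def)
  ultimately show ?thesis
    using assms by (simp add: deg_add_edge sum.distrib)
qed

definition edges_in_verts :: "mgraph \<Rightarrow> bool" where
  "edges_in_verts G \<longleftrightarrow> (\<forall>e. e \<in># edges G \<longrightarrow> set_uprod e \<subseteq> verts G)"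

lemma deg_sum_add_vertex:
  assumes "edges_in_verts G"
  shows "(\<Sum>w\<in>verts (add_vertex G). deg (add_vertex G) w) = (\<Sum>w\<in>verts G. deg G w)"
proof -
  have "deg (add_vertex G) w = deg G w" for w
    by (simp add: deg_def add_vertex_def)
  moreover have "deg G (nverts G) = 0"
  proof -
    have "nverts G \<notin> set_uprod e" if "e \<in># edges G" for e
      using assms that by (auto simp: edges_in_verts_def verts_def)
    moreover from this[of "Upair (nverts G) (nverts G)"]
    have "count (edges G) (Upair (nverts G) (nverts G)) = 0"
      by (auto simp: count_eq_zero_iff)
    ultimately show ?thesis
      by (auto simp: deg_def multiset_eq_iff count_eq_zero_iff)
  qed
  ultimately show ?thesis
    by (simp add: verts_def add_vertex_def)
qed

lemma pa_graph_invariant: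
  assumes "t \<ge> 1" "G \<in> set_pmf (pa_graph p t)"
  shows "edges_in_verts G \<and> (\<Sum>w\<in>verts G. deg G w) = 2 * t"
  using assms
proof (induction t arbitrary: G rule: nat_induct_at_least)
  case base
  then show ?case
    unfolding pa_graph_1 by (auto simp: loop_graph_def edges_in_verts_def verts_def deg_def)
next
  case (Suc t)
  then obtain H where H: "H \<in> set_pmf (pa_graph p t)" and G: "G \<in> set_pmf (pa_step p H)"
    by (auto simp: pa_graph_Suc)
  from Suc.IH[OF H] have wf: "edges_in_verts H" and ds: "(\<Sum>w\<in>verts H. deg H w) = 2 * t"
    by auto
  have pick: "set_pmf (pick_vertex H) \<subseteq> verts H"
    using set_pick_vertex[of H] ds Suc.hyps by simp
  from G consider "G \<in> set_pmf (vertex_step H)" | "G \<in> set_pmf (edge_step H)"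
    by (auto simp: pa_step_def split: if_splits)
  then show ?case
  proof cases
    case 1
    then obtain u where u: "u \<in> verts H" "G = add_edge (nverts H) u (add_vertex H)"
      using pick by (auto simp: vertex_step_def)
    have *: "u \<in> verts (add_vertex H)" "nverts H \<in> verts (add_vertex H)"
      using u by (auto simp: verts_def add_vertex_def)
    have "edges_in_verts G"
      using wf u by (fastforce simp: edges_in_verts_def verts_def add_vertex_def add_edge_def)
    then show ?thesis
      using deg_sum_add_edge[OF *(2,1)] deg_sum_add_vertex[OF wf] ds u by simp
  next
    case 2
    then obtain u v where u: "u \<in> verts H" "v \<in> verts H" "G = add_edge u v H"
      using pick by (auto simp: edge_step_def)
    have "edges_in_verts G"
      using wf u by (fastforce simp: edges_in_verts_def verts_def add_edge_def)
    then show ?thesis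
      using deg_sum_add_edge[OF u(1,2)] ds u by simp
  qed
qed

lemma pa_graph_deg_sum:
  assumes "t \<ge> 1" "G \<in> set_pmf (pa_graph p t)"
  shows "(\<Sum>w\<in>verts G. deg G w) = 2 * t"
  using pa_graph_invariant[OF assms] by simp

end

theory Submission
  imports Defs "HOL-Real_Asymp.Real_Asymp"
begin

text \<open>
  The clique consists of old vertices. Let \<open>N = t powr ((1 - p) / (2 - p)) / ln t powr (1 / (2 - p))\<close> and
  \<open>M = N / F\<close> with a slowly growing \<open>F\<close>, and look at the process at the three times \<open>M\<close>, \<open>t\<close> and
  \<open>2 * t\<close>.
  
  At time \<open>M\<close> there are about \<open>p * M\<close> vertices, hence with high probability at least
  \<open>m = p * M / 4\<close> (\<open>prob_few_verts_le\<close>).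
  
  Until time \<open>t\<close> each of them has its degree multiplied by a random factor of the order of
  \<open>(t / M) powr (1 - p / 2) = F powr (1 - p / 2) * sqrt (t * ln t)\<close>. For a single vertex the factor can
  be small, but the probability that the degree stays below \<open>D\<close>, a constant multiple of
  \<open>sqrt (t * ln t)\<close>, is at most a negative power of \<open>F\<close>. To see this, follow a weight of the degree
  which behaves like its inverse square root: its mean decays at the rate at which the
  deterministic growth would make it decay (\<open>deg_weight_drift\<close>). By Markov's inequality at least half
  of the \<open>m\<close> vertices have degree at least \<open>D\<close> with high probability
  (\<open>prob_many_small_degrees_le\<close>). The error of
  this stage vanishes because \<open>F\<close> tends to infinity, which is the reason for the factor \<open>f\<close> in the
  theorem.
  
  During the \<open>t\<close> steps that follow, the sum of the degrees is at most \<open>4 * t\<close>, and each step joins two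
  given vertices of degree at least \<open>D\<close> with probability at least \<open>(1 - p) * (D / (4 * t))\<^sup>2\<close>. A
  pair is therefore missed with probability at most \<open>exp (- (1 - p) * D\<^sup>2 / (16 * t))\<close>, which is
  \<open>1 / t ^ 3\<close> for a suitable constant in \<open>D\<close>, and a union bound over the pairs shows that the vertices
  of large degree form a clique (\<open>prob_clique_number_less_le\<close>).
  
  All estimates are of one kind: a nonnegative function of the time and the state whose conditional
  mean does not increase in a step (\<open>pa_from_supermartingale\<close>), followed by Markov's inequality.
\<close>

section \<open>Markov's inequality and conditioning for mass functions\<close>

lemma prob_pmf_Markov:
  fixes \<Phi> :: "'a \<Rightarrow> real"
  assumes "0 < c" "0 \<le> K"
    and int: "(\<integral>\<^sup>+x. ennreal (\<Phi> x) \<partial>measure_pmf M) \<le> ennreal K"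
    and large: "\<And>x. x \<in> set_pmf M \<Longrightarrow> x \<in> A \<Longrightarrow> c \<le> \<Phi> x"
  shows "measure_pmf.prob M A \<le> K / c"
proof -
  have "ennreal (c * measure_pmf.prob M A) = (\<integral>\<^sup>+x. ennreal c * indicator A x \<partial>measure_pmf M)"
    using assms(1) by (simp add: nn_integral_cmult measure_pmf.emeasure_eq_measure ennreal_mult)
  also have "\<dots> \<le> (\<integral>\<^sup>+x. ennreal (\<Phi> x) \<partial>measure_pmf M)"
    using large by (intro nn_integral_mono_AE)
      (auto simp: AE_measure_pmf_iff split: split_indicator intro!: ennreal_leI)
  also note int
  finally have "c * measure_pmf.prob M A \<le> K"
    using assms(2) by simp
  then show ?thesis
    using assms(1) by (simp add: field_simps)
qed

text \<open>
  This chains the stages of the argument: a failure of the second stage either follows a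
  failure \<open>A\<close> of the first one or starts from a good state.
\<close>

lemma prob_bind_pmf_le:
  assumes "0 \<le> e"
    and cond: "\<And>x. x \<in> set_pmf M \<Longrightarrow> x \<notin> A \<Longrightarrow> measure_pmf.prob (N x) B \<le> e"
  shows "measure_pmf.prob (bind_pmf M N) B \<le> measure_pmf.prob M A + e"
proof -
  have "ennreal (measure_pmf.prob (bind_pmf M N) B) = (\<integral>\<^sup>+x. emeasure (N x) B \<partial>measure_pmf M)"
    by (simp flip: measure_pmf.emeasure_eq_measure)
  also have "\<dots> \<le> (\<integral>\<^sup>+x. indicator A x + ennreal e \<partial>measure_pmf M)"
  proof (intro nn_integral_mono_AE, unfold AE_measure_pmf_iff, intro ballI)
    fix x assume "x \<in> set_pmf M"
    then show "emeasure (N x) B \<le> indicator A x + ennreal e"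
      using cond[of x] measure_pmf.emeasure_le_1[of "N x" B]
      by (cases "x \<in> A") (auto simp: measure_pmf.emeasure_eq_measure intro: ennreal_leI add_increasing2)
  qed
  also have "\<dots> = ennreal (measure_pmf.prob M A + e)"
    using assms(1) by (simp add: nn_integral_add measure_pmf.emeasure_eq_measure ennreal_plus)
  finally show ?thesis
    using assms(1) by (simp del: ennreal_plus)
qed

lemma nn_integral_bernoulli_pmf_real:
  fixes f :: "bool \<Rightarrow> real"
  assumes "0 \<le> q" "q \<le> 1" "\<And>b. 0 \<le> f b"
  shows "(\<integral>\<^sup>+b. ennreal (f b) \<partial>measure_pmf (bernoulli_pmf q))
       = ennreal (q * f True + (1 - q) * f False)"
  using assms by (simp add: mult.commute flip: ennreal_mult ennreal_plus)

lemma map_pmf_eq_bernoulli_pmf: "map_pmf (\<lambda>x. x = a) M = bernoulli_pmf (pmf M a)"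
proof (rule pmf_eqI)
  fix b
  have "(\<lambda>x. x = a) -` {True} = {a}" by auto
  then have "pmf (map_pmf (\<lambda>x. x = a) M) True = pmf M a"
    by (simp add: pmf_map measure_pmf_single)
  then show "pmf (map_pmf (\<lambda>x. x = a) M) b = pmf (bernoulli_pmf (pmf M a)) b"
    by (cases b) (simp_all add: pmf_False_conv_True pmf_le_1)
qed

section \<open>Growth of the graph along the process\<close>

text \<open>
  Only multiplicities of edges and the number of vertices can grow, so that degrees, adjacency and
  membership in the vertex set all persist along this order.
\<close>

definition subgraph :: "mgraph \<Rightarrow> mgraph \<Rightarrow> bool" where
  "subgraph G H \<longleftrightarrow> nverts G \<le> nverts H \<and> edges G \<subseteq># edges H"

lemma subgraph_refl: "subgraph G G"
  by (simp add: subgraph_def)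

lemma subgraph_trans: "subgraph G H \<Longrightarrow> subgraph H K \<Longrightarrow> subgraph G K"
  by (auto simp: subgraph_def intro: subset_mset.trans)

lemma deg_mono: "subgraph G H \<Longrightarrow> deg G u \<le> deg H u"
  unfolding subgraph_def deg_def
  by (intro add_mono size_mset_mono multiset_filter_mono mset_subset_eq_count) auto

lemma deg_add_vertex: "deg (add_vertex G) u = deg G u"
  by (simp add: deg_def add_vertex_def)

lemma deg_le_twice_time:
  assumes "t \<ge> 1" "G \<in> set_pmf (pa_graph p t)" "u \<in> verts G"
  shows "deg G u \<le> 2 * t"
proof -
  have "deg G u \<le> (\<Sum>w\<in>verts G. deg G w)"
    using assms(3) by (intro member_le_sum) (auto simp: verts_def)
  then show ?thesis using pa_graph_deg_sum[OF assms(1,2)] by simp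
qed

lemma pmf_pick_vertex_pa_graph:
  assumes "t \<ge> 1" "G \<in> set_pmf (pa_graph p t)" "u \<in> verts G"
  shows "pmf (pick_vertex G) u = real (deg G u) / (2 * real t)"
  using pa_graph_deg_sum[OF assms(1,2)] assms
  by (subst pmf_pick_vertex) (simp_all)

lemma pa_step_cases:
  assumes "t \<ge> 1" "G \<in> set_pmf (pa_graph p t)" "H \<in> set_pmf (pa_step p G)"
  obtains (vertex) u where "u \<in> verts G" "H = add_edge (nverts G) u (add_vertex G)"
  | (edge) u v where "u \<in> verts G" "v \<in> verts G" "H = add_edge u v G"
proof -
  have pick: "set_pmf (pick_vertex G) \<subseteq> verts G"
    using set_pick_vertex[of G] pa_graph_deg_sum[OF assms(1,2)] assms(1) by simp
  from assms(3) consider "H \<in> set_pmf (vertex_step G)" | "H \<in> set_pmf (edge_step G)"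
    by (auto simp: pa_step_def split: if_splits)
  then show ?thesis
  proof cases
    case 1
    then show ?thesis using pick vertex by (auto simp: vertex_step_def)
  next
    case 2
    then obtain u v where "u \<in> set_pmf (pick_vertex G)" "v \<in> set_pmf (pick_vertex G)" "H = add_edge u v G"
      by (auto simp: edge_step_def)
    then show ?thesis using pick edge by blast
  qed
qed

lemma subgraph_pa_step:
  assumes "t \<ge> 1" "G \<in> set_pmf (pa_graph p t)" "H \<in> set_pmf (pa_step p G)"
  shows "subgraph G H"
  using assms by (cases rule: pa_step_cases) (auto simp: subgraph_def add_edge_def add_vertex_def)

lemma deg_pos_pa_graph:
  assumes "t \<ge> 1" "G \<in> set_pmf (pa_graph p t)" "u \<in> verts G"
  shows "1 \<le> deg G u"
  using assms
proof (induction t arbitrary: G rule: nat_induct_at_least)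
  case base
  then show ?case
    unfolding pa_graph_1 by (auto simp: loop_graph_def verts_def deg_def)
next
  case (Suc t)
  then obtain H where H: "H \<in> set_pmf (pa_graph p t)" and G: "G \<in> set_pmf (pa_step p H)"
    by (auto simp: pa_graph_Suc)
  show ?case
  proof (cases "u \<in> verts H")
    case True
    then show ?thesis
      using Suc.IH[OF H] deg_mono[OF subgraph_pa_step[OF Suc.hyps H G], of u] by simp
  next
    case False
    then show ?thesis
      using Suc.prems(2)
      by (cases rule: pa_step_cases[OF Suc.hyps H G])
         (auto simp: verts_def add_edge_def add_vertex_def deg_def)
  qed
qed

text \<open>
  The process run for \<open>n\<close> further steps from the state \<open>G\<close>. It carries no time of its own: the law
  of a step depends on the time only through the sum of the degrees in the current state.
\<close>

definition pa_from :: "real \<Rightarrow> nat \<Rightarrow> mgraph \<Rightarrow> mgraph pmf" where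
  "pa_from p n G = ((\<lambda>\<mu>. bind_pmf \<mu> (pa_step p)) ^^ n) (return_pmf G)"

lemma pa_from_0: "pa_from p 0 G = return_pmf G"
  by (simp add: pa_from_def)

lemma pa_from_Suc: "pa_from p (Suc n) G = bind_pmf (pa_from p n G) (pa_step p)"
  by (simp add: pa_from_def)

lemma pa_graph_eq_pa_from: "pa_graph p t = pa_from p (t - 1) loop_graph"
  by (simp add: pa_graph_def pa_from_def)

lemma pa_graph_add:
  "t \<ge> 1 \<Longrightarrow> pa_graph p (t + n) = bind_pmf (pa_graph p t) (pa_from p n)"
proof (induction n)
  case 0
  have "pa_from p 0 = return_pmf" by (simp add: fun_eq_iff pa_from_0)
  then show ?case by (simp add: bind_return_pmf')
next
  case (Suc n)
  have "pa_from p (Suc n) = (\<lambda>G. bind_pmf (pa_from p n G) (pa_step p))"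
    by (simp add: fun_eq_iff pa_from_Suc)
  with Suc show ?case by (simp add: pa_graph_Suc bind_assoc_pmf)
qed

lemma set_pa_from:
  assumes "t \<ge> 1" "G \<in> set_pmf (pa_graph p t)" "H \<in> set_pmf (pa_from p n G)"
  shows "H \<in> set_pmf (pa_graph p (t + n))" "subgraph G H"
proof -
  show "H \<in> set_pmf (pa_graph p (t + n))"
    using assms by (auto simp: pa_graph_add)
  show "subgraph G H"
    using assms(3)
  proof (induction n arbitrary: H)
    case 0
    then show ?case by (simp add: pa_from_0 subgraph_refl)
  next
    case (Suc n)
    then obtain K where K: "K \<in> set_pmf (pa_from p n G)" "H \<in> set_pmf (pa_step p K)"
      by (auto simp: pa_from_Suc)
    moreover have "K \<in> set_pmf (pa_graph p (t + n))"
      using K assms by (auto simp: pa_graph_add)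
    ultimately show ?case
      using Suc.IH[OF K(1)] subgraph_pa_step[of "t + n" K p H] assms(1) subgraph_trans by auto
  qed
qed

text \<open>
  The potential may depend on the time, which absorbs step-dependent contraction factors. The one-step
  bound is required only for states that the process reaches from \<open>G\<close>, because the probabilities of
  \<open>pick_vertex\<close> are known there, and because there degrees are at least those of \<open>G\<close>.
\<close>

lemma pa_from_supermartingale:
  fixes \<Phi> :: "nat \<Rightarrow> mgraph \<Rightarrow> real"
  assumes t: "t \<ge> 1" and G: "G \<in> set_pmf (pa_graph p t)"
    and step: "\<And>s H. t \<le> s \<Longrightarrow> s < t + n \<Longrightarrow> H \<in> set_pmf (pa_graph p s) \<Longrightarrow> subgraph G H
      \<Longrightarrow> (\<integral>\<^sup>+K. ennreal (\<Phi> (Suc s) K) \<partial>measure_pmf (pa_step p H)) \<le> ennreal (\<Phi> s H)"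
  shows "(\<integral>\<^sup>+H. ennreal (\<Phi> (t + n) H) \<partial>measure_pmf (pa_from p n G)) \<le> ennreal (\<Phi> t G)"
  using step
proof (induction n)
  case 0
  then show ?case by (simp add: pa_from_0)
next
  case (Suc n)
  have "(\<integral>\<^sup>+H. ennreal (\<Phi> (t + Suc n) H) \<partial>measure_pmf (pa_from p (Suc n) G))
      = (\<integral>\<^sup>+H. (\<integral>\<^sup>+K. ennreal (\<Phi> (Suc (t + n)) K) \<partial>measure_pmf (pa_step p H)) \<partial>measure_pmf (pa_from p n G))"
    by (simp add: pa_from_Suc)
  also have "\<dots> \<le> (\<integral>\<^sup>+H. ennreal (\<Phi> (t + n) H) \<partial>measure_pmf (pa_from p n G))"
    using set_pa_from[OF t G]
    by (intro nn_integral_mono_AE) (auto simp: AE_measure_pmf_iff intro!: Suc.prems)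
  also have "\<dots> \<le> ennreal (\<Phi> t G)"
    by (intro Suc.IH Suc.prems) auto
  finally show ?case .
qed

lemma nn_integral_pa_step:
  assumes "0 < p" "p < 1"
    and V: "(\<integral>\<^sup>+H. f H \<partial>measure_pmf (vertex_step G)) \<le> ennreal a" "0 \<le> a"
    and E: "(\<integral>\<^sup>+H. f H \<partial>measure_pmf (edge_step G)) \<le> ennreal b" "0 \<le> b"
  shows "(\<integral>\<^sup>+H. f H \<partial>measure_pmf (pa_step p G)) \<le> ennreal (p * a + (1 - p) * b)"
proof -
  have "(\<integral>\<^sup>+H. f H \<partial>measure_pmf (pa_step p G))
      \<le> (\<integral>\<^sup>+c. ennreal (if c then a else b) \<partial>measure_pmf (bernoulli_pmf p))"
    unfolding pa_step_def nn_integral_bind_pmf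
    using V E by (intro nn_integral_mono) auto
  then show ?thesis
    using assms by (subst (asm) nn_integral_bernoulli_pmf_real) auto
qed

section \<open>Many vertices at an early time\<close>

lemma nverts_vertex_step:
  "H \<in> set_pmf (vertex_step G) \<Longrightarrow> nverts H = Suc (nverts G)"
  by (auto simp: vertex_step_def add_edge_def add_vertex_def)

lemma nverts_edge_step:
  "H \<in> set_pmf (edge_step G) \<Longrightarrow> nverts H = nverts G"
  by (auto simp: edge_step_def add_edge_def)

text \<open>
  The number of vertices grows by independent Bernoulli steps. A Chernoff bound with base \<open>1 / 2\<close>
  suffices: a step multiplies the mean of \<open>(1 / 2) ^ nverts\<close> by \<open>1 - p / 2 \<le> exp (- p / 2)\<close>.
\<close>

lemma prob_few_verts_le:
  assumes p: "0 < p" "p < 1" and M: "M \<ge> 1"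
  shows "measure_pmf.prob (pa_graph p M) {G. nverts G < m} \<le> 2 ^ m * exp (- p / 2 * (real M - 1))"
proof -
  define r where "r = exp (p / 2)"
  define \<Phi> where "\<Phi> s G = (1 / 2) ^ nverts G * r ^ s" for s G
  have r: "0 < r" "r * (1 - p / 2) \<le> 1"
    using exp_ge_add_one_self[of "- p / 2"] by (auto simp: r_def exp_minus field_simps)
  have "(\<integral>\<^sup>+H. ennreal (\<Phi> (1 + (M - 1)) H) \<partial>measure_pmf (pa_from p (M - 1) loop_graph))
      \<le> ennreal (\<Phi> 1 loop_graph)"
  proof (rule pa_from_supermartingale)
    fix s G
    have "(\<integral>\<^sup>+H. ennreal (\<Phi> (Suc s) H) \<partial>measure_pmf (pa_step p G))
        \<le> ennreal (p * (r * \<Phi> s G / 2) + (1 - p) * (r * \<Phi> s G))"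
    proof (rule nn_integral_pa_step[OF p])
      have "(\<integral>\<^sup>+H. ennreal (\<Phi> (Suc s) H) \<partial>measure_pmf (vertex_step G))
          = (\<integral>\<^sup>+H. ennreal (r * \<Phi> s G / 2) \<partial>measure_pmf (vertex_step G))"
        by (intro nn_integral_cong_AE) (auto simp: AE_measure_pmf_iff nverts_vertex_step \<Phi>_def mult_ac)
      then show "(\<integral>\<^sup>+H. ennreal (\<Phi> (Suc s) H) \<partial>measure_pmf (vertex_step G)) \<le> ennreal (r * \<Phi> s G / 2)"
        by simp
      have "(\<integral>\<^sup>+H. ennreal (\<Phi> (Suc s) H) \<partial>measure_pmf (edge_step G))
          = (\<integral>\<^sup>+H. ennreal (r * \<Phi> s G) \<partial>measure_pmf (edge_step G))"
        by (intro nn_integral_cong_AE) (auto simp: AE_measure_pmf_iff nverts_edge_step \<Phi>_def mult_ac)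
      then show "(\<integral>\<^sup>+H. ennreal (\<Phi> (Suc s) H) \<partial>measure_pmf (edge_step G)) \<le> ennreal (r * \<Phi> s G)"
        by simp
    qed (use r in \<open>auto simp: \<Phi>_def\<close>)
    also have "p * (r * \<Phi> s G / 2) + (1 - p) * (r * \<Phi> s G) = r * (1 - p / 2) * \<Phi> s G"
      by (simp add: algebra_simps)
    also have "\<dots> \<le> 1 * \<Phi> s G"
      using r by (intro mult_right_mono) (auto simp: \<Phi>_def)
    finally show "(\<integral>\<^sup>+H. ennreal (\<Phi> (Suc s) H) \<partial>measure_pmf (pa_step p G)) \<le> ennreal (\<Phi> s G)"
      by (simp add: ennreal_leI)
  qed (auto simp: pa_graph_1[unfolded One_nat_def])
  then have "(\<integral>\<^sup>+H. ennreal (\<Phi> M H) \<partial>measure_pmf (pa_graph p M)) \<le> ennreal (\<Phi> 1 loop_graph)"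
    using M by (simp add: pa_graph_eq_pa_from)
  then have "measure_pmf.prob (pa_graph p M) {G. nverts G < m} \<le> \<Phi> 1 loop_graph / ((1 / 2) ^ m * r ^ M)"
    using r by (intro prob_pmf_Markov) (auto simp: \<Phi>_def intro!: power_decreasing)
  also have "\<dots> = 2 ^ m * (r / r ^ M) / 2"
    by (simp add: \<Phi>_def loop_graph_def field_simps)
  also have "\<dots> \<le> 2 ^ m * (r / r ^ M)"
  proof -
    have "x / 2 \<le> x" if "0 \<le> x" for x :: real using that by simp
    from this[of "2 ^ m * (r / r ^ M)"] show ?thesis using r(1) by (simp del: times_divide_eq_right)
  qed
  also have "r / r ^ M = exp (- p / 2 * (real M - 1))"
    by (simp add: r_def flip: exp_of_nat_mult exp_diff) (simp add: field_simps)
  finally show ?thesis .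
qed

section \<open>Degrees are rarely small\<close>

text \<open>
  This is \<open>\<Gamma> (d - 1/2) / (\<Gamma> (1/2) * \<Gamma> d)\<close> for \<open>d \<ge> 1\<close>, of the order of \<open>d powr (- 1/2)\<close>. The power
  itself would not do: for \<open>d = 1\<close> an increment shrinks it by too little, and the loss would change the
  exponent of the tail bound. With the product, an increment of \<open>d\<close> costs exactly the
  fraction \<open>1 / (2 * d)\<close>. The exponent \<open>1/2\<close> could be any number strictly between 0 and 1; at 1 the
  weight would vanish from \<open>d = 2\<close> on.
\<close>

definition deg_weight :: "nat \<Rightarrow> real" where
  "deg_weight d = (\<Prod>j = 1..<d. 1 - 1 / (2 * real j))"

lemma deg_weight_Suc: "deg_weight (Suc d) = deg_weight d * (1 - 1 / (2 * real d))"
  by (cases d) (simp_all add: deg_weight_def)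

lemma deg_weight_pos: "0 < deg_weight d"
  unfolding deg_weight_def by (intro prod_pos) auto

lemma deg_weight_antimono: "d \<le> e \<Longrightarrow> deg_weight e \<le> deg_weight d"
proof (induction e rule: dec_induct)
  case (step e)
  have "deg_weight (Suc e) \<le> deg_weight e * 1"
    unfolding deg_weight_Suc using deg_weight_pos[of e] by (intro mult_left_mono) auto
  with step.IH show ?case by simp
qed simp

lemma deg_weight_le_1: "deg_weight d \<le> 1"
  using deg_weight_antimono[of 0 d] by (simp add: deg_weight_def)

lemma deg_weight_ge:
  assumes "d \<ge> 2"
  shows "1 / (2 * sqrt (real d)) \<le> deg_weight d"
proof -
  \<comment> \<open>The bound with \<open>d - 1\<close> is the one that reproduces itself: it rests on
    \<open>d * (d - 1) \<le> (d - 1/2)\<^sup>2\<close>, whereas the bound with \<open>d\<close> is not inductive.\<close>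
  have "1 / (2 * sqrt (real d - 1)) \<le> deg_weight d"
    using assms
  proof (induction d rule: nat_induct_at_least)
    case base
    then show ?case by (simp add: deg_weight_def numeral_2_eq_2)
  next
    case (Suc d)
    have d: "real d \<ge> 2" using Suc.hyps by simp
    have "sqrt (real d * (real d - 1)) \<le> real d - 1 / 2"
    proof (rule real_le_lsqrt)
      show "real d * (real d - 1) \<le> (real d - 1 / 2)\<^sup>2"
        by (simp add: power2_eq_square algebra_simps)
    qed (use d in auto)
    moreover have "sqrt (real d) * sqrt (real d) = real d" by simp
    ultimately have "sqrt (real d - 1) * real d \<le> sqrt (real d) * (real d - 1 / 2)"
      using d mult_left_mono[of "sqrt (real d * (real d - 1))" "real d - 1 / 2" "sqrt (real d)"]
      by (simp add: real_sqrt_mult mult_ac flip: mult.assoc)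
    then have "1 / (2 * sqrt (real d)) \<le> 1 / (2 * sqrt (real d - 1)) * (1 - 1 / (2 * real d))"
      using d by (simp add: field_simps)
    also have "\<dots> \<le> deg_weight d * (1 - 1 / (2 * real d))"
      using Suc.IH d by (intro mult_right_mono) auto
    finally show ?case by (simp add: deg_weight_Suc)
  qed
  moreover have "1 / (2 * sqrt (real d)) \<le> 1 / (2 * sqrt (real d - 1))"
    using assms by (intro divide_left_mono) auto
  ultimately show ?thesis by simp
qed

text \<open>
  Under both operations each random endpoint hits \<open>u\<close> with the same probability \<open>q\<close>, so the degree
  of \<open>u\<close> grows by a Bernoulli variable, or by a sum of two independent ones.
\<close>

lemma nn_integral_deg_vertex_step:
  fixes \<phi> :: "nat \<Rightarrow> real"
  assumes t: "t \<ge> 1" "G \<in> set_pmf (pa_graph p t)" "u \<in> verts G" and \<phi>: "\<And>d. 0 \<le> \<phi> d"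
  defines "q \<equiv> real (deg G u) / (2 * real t)"
  shows "(\<integral>\<^sup>+H. ennreal (\<phi> (deg H u)) \<partial>measure_pmf (vertex_step G))
    = ennreal (q * \<phi> (deg G u + 1) + (1 - q) * \<phi> (deg G u))"
proof -
  have q: "0 \<le> q" "q \<le> 1"
    using deg_le_twice_time[OF t] t(1) by (auto simp: q_def field_simps)
  have u: "u \<noteq> nverts G" using t(3) by (simp add: verts_def)
  have "(\<integral>\<^sup>+H. ennreal (\<phi> (deg H u)) \<partial>measure_pmf (vertex_step G))
      = (\<integral>\<^sup>+b. ennreal (\<phi> (deg G u + of_bool b)) \<partial>measure_pmf (map_pmf (\<lambda>w. w = u) (pick_vertex G)))"
    unfolding vertex_step_def nn_integral_map_pmf
    using u by (intro nn_integral_cong) (auto simp: deg_add_edge deg_add_vertex)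
  also have "\<dots> = ennreal (q * \<phi> (deg G u + 1) + (1 - q) * \<phi> (deg G u))"
    unfolding map_pmf_eq_bernoulli_pmf pmf_pick_vertex_pa_graph[OF t] q_def[symmetric]
    using q \<phi> by (subst nn_integral_bernoulli_pmf_real) auto
  finally show ?thesis .
qed

lemma nn_integral_deg_edge_step:
  fixes \<phi> :: "nat \<Rightarrow> real"
  assumes t: "t \<ge> 1" "G \<in> set_pmf (pa_graph p t)" "u \<in> verts G" and \<phi>: "\<And>d. 0 \<le> \<phi> d"
  defines "q \<equiv> real (deg G u) / (2 * real t)"
  shows "(\<integral>\<^sup>+H. ennreal (\<phi> (deg H u)) \<partial>measure_pmf (edge_step G))
    = ennreal (q * (q * \<phi> (deg G u + 2) + (1 - q) * \<phi> (deg G u + 1))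
             + (1 - q) * (q * \<phi> (deg G u + 1) + (1 - q) * \<phi> (deg G u)))"
proof -
  have q: "0 \<le> q" "q \<le> 1"
    using deg_le_twice_time[OF t] t(1) by (auto simp: q_def field_simps)
  let ?B = "map_pmf (\<lambda>w. w = u) (pick_vertex G)"
  have "(\<integral>\<^sup>+H. ennreal (\<phi> (deg H u)) \<partial>measure_pmf (edge_step G))
      = (\<integral>\<^sup>+a. (\<integral>\<^sup>+b. ennreal (\<phi> (deg G u + of_bool a + of_bool b)) \<partial>measure_pmf ?B) \<partial>measure_pmf ?B)"
    unfolding edge_step_def nn_integral_map_pmf nn_integral_pair_pmf'
    by (intro nn_integral_cong) (auto simp: deg_add_edge)
  also have "\<dots> = (\<integral>\<^sup>+a. ennreal (q * \<phi> (deg G u + of_bool a + 1) + (1 - q) * \<phi> (deg G u + of_bool a)) \<partial>measure_pmf ?B)"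
    unfolding map_pmf_eq_bernoulli_pmf pmf_pick_vertex_pa_graph[OF t] q_def[symmetric]
    using q \<phi> by (subst nn_integral_bernoulli_pmf_real) auto
  also have "\<dots> = ennreal (q * (q * \<phi> (deg G u + 2) + (1 - q) * \<phi> (deg G u + 1))
             + (1 - q) * (q * \<phi> (deg G u + 1) + (1 - q) * \<phi> (deg G u)))"
    unfolding map_pmf_eq_bernoulli_pmf pmf_pick_vertex_pa_graph[OF t] q_def[symmetric]
    using q \<phi> by (subst nn_integral_bernoulli_pmf_real) auto
  finally show ?thesis .
qed

text \<open>
  An endpoint hits \<open>u\<close> with probability \<open>d / (2 * t)\<close> and then costs the fraction \<open>1 / (2 * d)\<close> of the
  weight. The degree cancels: a vertex step costs \<open>1 / (4 * t)\<close> and an edge step twice as much, up to an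
  error of order \<open>1 / t\<^sup>2\<close> because both endpoints may hit \<open>u\<close>. The average is
  \<open>(2 - p) / 4 / t\<close>, and writing \<open>t + 3\<close> for \<open>t\<close> pays for the error term.
\<close>

lemma deg_weight_drift:
  assumes p: "0 < p" "p < 1" and t: "t \<ge> 1" "G \<in> set_pmf (pa_graph p t)" "u \<in> verts G"
  shows "(\<integral>\<^sup>+H. ennreal (deg_weight (deg H u)) \<partial>measure_pmf (pa_step p G))
    \<le> ennreal (deg_weight (deg G u) * (1 - (2 - p) / 4 / (real t + 3)))"
proof -
  define d where "d = deg G u"
  define x where "x = real d"
  define s where "s = real t"
  define w where "w = deg_weight d"
  define q where "q = x / (2 * s)"
  have s: "1 \<le> s" and x: "1 \<le> x" "x \<le> 2 * s"
    using t(1) deg_pos_pa_graph[OF t] deg_le_twice_time[OF t] by (auto simp: s_def x_def d_def)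
  have q: "0 \<le> q" "q \<le> 1" using s x by (auto simp: q_def field_simps)
  have w: "0 < w" by (simp add: w_def deg_weight_pos)
  have w1: "deg_weight (d + 1) = w * (1 - 1 / (2 * x))"
    by (simp add: deg_weight_Suc w_def x_def)
  have w2: "deg_weight (d + 2) = w * (1 - 1 / (2 * x)) * (1 - 1 / (2 * (x + 1)))"
    by (simp add: deg_weight_Suc w_def x_def add.commute)
  define V where "V = q * deg_weight (d + 1) + (1 - q) * w"
  define E where "E = q * (q * deg_weight (d + 2) + (1 - q) * deg_weight (d + 1))
    + (1 - q) * (q * deg_weight (d + 1) + (1 - q) * w)"
  have qx: "q / x = 1 / (2 * s)" using x s by (simp add: q_def)
  have V: "V = w * (1 - q / x / 2)"
    unfolding V_def w1 using x by (simp add: field_simps)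
  have E: "E = w * (1 - q / x + 3 / 4 * (q / x)\<^sup>2 * (x / (x + 1)))"
    unfolding E_def w1 w2 using x by (simp add: divide_simps) (simp add: algebra_simps power2_eq_square)
  have V': "V = w * (1 - 1 / (4 * s))"
    unfolding V qx by simp
  have "x / (x + 1) \<le> 1" using x by simp
  then have "3 / 4 * (1 / (2 * s))\<^sup>2 * (x / (x + 1)) \<le> 3 / 4 * (1 / (2 * s))\<^sup>2 * 1"
    by (intro mult_left_mono) auto
  then have E': "E \<le> w * (1 - 1 / (2 * s) + 3 / 16 / s\<^sup>2)"
    unfolding E qx using w by (intro mult_left_mono) (auto simp: power2_eq_square)
  have "(\<integral>\<^sup>+H. ennreal (deg_weight (deg H u)) \<partial>measure_pmf (pa_step p G))
      \<le> ennreal (p * V + (1 - p) * E)"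
  proof (rule nn_integral_pa_step[OF p])
    show "(\<integral>\<^sup>+H. ennreal (deg_weight (deg H u)) \<partial>measure_pmf (vertex_step G)) \<le> ennreal V"
      using nn_integral_deg_vertex_step[OF t, of deg_weight] deg_weight_pos
      by (simp add: V_def q_def x_def d_def s_def w_def less_imp_le)
    show "(\<integral>\<^sup>+H. ennreal (deg_weight (deg H u)) \<partial>measure_pmf (edge_step G)) \<le> ennreal E"
      using nn_integral_deg_edge_step[OF t, of deg_weight] deg_weight_pos
      by (simp add: E_def q_def x_def d_def s_def w_def less_imp_le)
    show "0 \<le> V" "0 \<le> E"
      using q w by (auto simp: V_def E_def less_imp_le deg_weight_pos intro!: add_nonneg_nonneg mult_nonneg_nonneg)
  qed
  also have "p * V + (1 - p) * E \<le> w * (1 - (2 - p) / 4 / (s + 3))"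
  proof -
    have "p * V + (1 - p) * E
        \<le> p * (w * (1 - 1 / (4 * s))) + (1 - p) * (w * (1 - 1 / (2 * s) + 3 / 16 / s\<^sup>2))"
      unfolding V' using E' p by (intro add_mono mult_left_mono[OF E']) auto
    also have "\<dots> = w * (1 - (2 - p) / 4 / s + (1 - p) * (3 / 16 / s\<^sup>2))"
      using s by (simp add: field_simps)
    also have "\<dots> \<le> w * (1 - (2 - p) / 4 / (s + 3))"
    proof (intro mult_left_mono)
      have "(1 - p) * (3 / 16 / s\<^sup>2) \<le> 1 * (3 / 16 / s\<^sup>2)"
        using p by (intro mult_right_mono) auto
      also have "\<dots> \<le> 1 / 4 * (3 / (s * (s + 3)))"
      proof -
        have "4 * (s * (s + 3)) \<le> 16 * s\<^sup>2"
          using mult_left_mono[of "s + 3" "4 * s" s] s by (simp add: power2_eq_square)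
        then have "3 / (16 * s\<^sup>2) \<le> 3 / (4 * (s * (s + 3)))"
          using s by (intro divide_left_mono) auto
        then show ?thesis by simp
      qed
      also have "\<dots> \<le> (2 - p) / 4 * (3 / (s * (s + 3)))"
        using s p by (intro mult_right_mono) auto
      also have "\<dots> = (2 - p) / 4 / s - (2 - p) / 4 / (s + 3)"
        using s by (simp add: divide_simps) (simp add: algebra_simps)
      finally show "1 - (2 - p) / 4 / s + (1 - p) * (3 / 16 / s\<^sup>2) \<le> 1 - (2 - p) / 4 / (s + 3)"
        by simp
    qed (use w in simp)
    finally show ?thesis .
  qed
  finally show ?thesis
    by (simp add: w_def d_def s_def ennreal_leI)
qed

text \<open>
  With this bound the contraction factors of successive steps telescope to a power of a quotient.
\<close>

lemma one_minus_le_powr_quotient: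
  fixes x b :: real
  assumes "0 < x" "0 \<le> b"
  shows "1 - b / x \<le> (x / (x + 1)) powr b"
proof -
  have "1 - b / x \<le> exp (- (b / x))"
    using exp_ge_add_one_self[of "- (b / x)"] by simp
  also have "\<dots> \<le> exp (b * ln (x / (x + 1)))"
  proof -
    have "ln ((x + 1) / x) \<le> 1 / x"
      using assms ln_add_one_self_le_self[of "1 / x"] by (simp add: add_divide_distrib add.commute)
    then have "b * ln ((x + 1) / x) \<le> b * (1 / x)"
      using assms by (intro mult_left_mono)
    then show ?thesis using assms by (simp add: ln_div algebra_simps)
  qed
  also have "\<dots> = (x / (x + 1)) powr b"
    using assms by (simp add: powr_def)
  finally show ?thesis .
qed

text \<open>
  Every vertex present at time \<open>M\<close> has degree at least 1, so its weight starts at most at 1, and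
  it decays in the mean like \<open>(M / t) powr ((2 - p) / 4)\<close> until time \<open>t = M + n\<close>. A vertex of degree
  below \<open>D\<close> has weight at least \<open>1 / (2 * sqrt D)\<close>.
  Markov's inequality is applied to the sum of the weights of the first \<open>m\<close>
  vertices. Only a fraction of them is claimed to have large degree; asking it of all of them
  would cost a union bound that the tail of a single degree cannot pay for.
\<close>

lemma prob_many_small_degrees_le:
  assumes p: "0 < p" "p < 1" and M: "M \<ge> 1" "G \<in> set_pmf (pa_graph p M)" "m \<le> nverts G"
    and D: "D \<ge> 2"
  shows "measure_pmf.prob (pa_from p n G) {H. m < 2 * card {u\<in>{..<m}. deg H u < D}}
    \<le> 4 * sqrt (real D) * ((real M + 3) / (real (M + n) + 3)) powr ((2 - p) / 4)"
proof (cases "m = 0")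
  case True
  then show ?thesis by simp
next
  case False
  define b where "b = (2 - p) / 4"
  have b: "0 \<le> b" using p by (simp add: b_def)
  define \<Phi> where "\<Phi> s H = (\<Sum>u<m. (real s + 3) powr b * deg_weight (deg H u))" for s H
  have "(\<integral>\<^sup>+H. ennreal (\<Phi> (M + n) H) \<partial>measure_pmf (pa_from p n G)) \<le> ennreal (\<Phi> M G)"
  proof (rule pa_from_supermartingale[OF M(1,2)])
    fix s H
    assume s: "M \<le> s" "H \<in> set_pmf (pa_graph p s)" "subgraph G H"
    have s1: "s \<ge> 1" using s(1) M(1) by simp
    have "(\<integral>\<^sup>+K. ennreal (\<Phi> (Suc s) K) \<partial>measure_pmf (pa_step p H))
        = (\<Sum>u<m. ennreal ((real s + 4) powr b) * (\<integral>\<^sup>+K. ennreal (deg_weight (deg K u)) \<partial>measure_pmf (pa_step p H)))"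
      by (simp add: \<Phi>_def less_imp_le deg_weight_pos ennreal_mult add.commute
          nn_integral_sum nn_integral_cmult flip: sum_ennreal)
    also have "\<dots> \<le> (\<Sum>u<m. ennreal ((real s + 3) powr b * deg_weight (deg H u)))"
    proof (rule sum_mono)
      fix u assume "u \<in> {..<m}"
      then have u: "u \<in> verts H" using M(3) s(3) by (auto simp: verts_def subgraph_def)
      have "1 - b / (real s + 3) \<le> ((real s + 3) / (real s + 4)) powr b"
        using one_minus_le_powr_quotient[of "real s + 3" b] b by (simp add: add.commute)
      then have "(real s + 4) powr b * (deg_weight (deg H u) * (1 - b / (real s + 3)))
          \<le> (real s + 4) powr b * (deg_weight (deg H u) * ((real s + 3) / (real s + 4)) powr b)"
        using deg_weight_pos by (intro mult_left_mono) (auto simp: less_imp_le)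
      also have "\<dots> = (real s + 3) powr b * deg_weight (deg H u)"
        by (simp add: powr_divide)
      finally have le: "(real s + 4) powr b * (deg_weight (deg H u) * (1 - b / (real s + 3)))
          \<le> (real s + 3) powr b * deg_weight (deg H u)" .
      have "ennreal ((real s + 4) powr b) * (\<integral>\<^sup>+K. ennreal (deg_weight (deg K u)) \<partial>measure_pmf (pa_step p H))
          \<le> ennreal ((real s + 4) powr b) * ennreal (deg_weight (deg H u) * (1 - b / (real s + 3)))"
        using deg_weight_drift[OF p s1 s(2) u] by (intro mult_left_mono) (auto simp: b_def)
      also have "\<dots> = ennreal ((real s + 4) powr b * (deg_weight (deg H u) * (1 - b / (real s + 3))))"
        by (simp add: ennreal_mult')
      also note ennreal_leI[OF le]
      finally show "ennreal ((real s + 4) powr b) * (\<integral>\<^sup>+K. ennreal (deg_weight (deg K u)) \<partial>measure_pmf (pa_step p H))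
          \<le> ennreal ((real s + 3) powr b * deg_weight (deg H u))" .
    qed
    also have "\<dots> = ennreal (\<Phi> s H)"
      by (simp add: \<Phi>_def less_imp_le deg_weight_pos)
    finally show "(\<integral>\<^sup>+K. ennreal (\<Phi> (Suc s) K) \<partial>measure_pmf (pa_step p H)) \<le> ennreal (\<Phi> s H)" .
  qed
  also have "\<Phi> M G \<le> (\<Sum>u<m. (real M + 3) powr b * 1)"
    unfolding \<Phi>_def by (intro sum_mono mult_left_mono deg_weight_le_1) auto
  finally have int: "(\<integral>\<^sup>+H. ennreal (\<Phi> (M + n) H) \<partial>measure_pmf (pa_from p n G))
      \<le> ennreal (real m * (real M + 3) powr b)"
    by (simp add: ennreal_leI)
  have "measure_pmf.prob (pa_from p n G) {H. m < 2 * card {u\<in>{..<m}. deg H u < D}}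
      \<le> real m * (real M + 3) powr b / (real m / 2 * ((real (M + n) + 3) powr b * (1 / (2 * sqrt D))))"
  proof (rule prob_pmf_Markov[OF _ _ int])
    fix H assume "H \<in> {H. m < 2 * card {u\<in>{..<m}. deg H u < D}}"
    then have card: "real m / 2 \<le> real (card {u\<in>{..<m}. deg H u < D})" by simp
    have "real m / 2 * ((real (M + n) + 3) powr b * (1 / (2 * sqrt D)))
        \<le> real (card {u\<in>{..<m}. deg H u < D}) * ((real (M + n) + 3) powr b * (1 / (2 * sqrt D)))"
      using card by (intro mult_right_mono) auto
    also have "\<dots> = (\<Sum>u\<in>{u\<in>{..<m}. deg H u < D}. (real (M + n) + 3) powr b * (1 / (2 * sqrt D)))"
      by simp
    also have "\<dots> \<le> (\<Sum>u\<in>{u\<in>{..<m}. deg H u < D}. (real (M + n) + 3) powr b * deg_weight (deg H u))"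
      using deg_weight_ge[OF D] deg_weight_antimono[of _ D]
      by (intro sum_mono mult_left_mono) (auto intro: order_trans less_imp_le)
    also have "\<dots> \<le> \<Phi> (M + n) H"
      unfolding \<Phi>_def using deg_weight_pos by (intro sum_mono2) (auto simp: less_imp_le)
    finally show "real m / 2 * ((real (M + n) + 3) powr b * (1 / (2 * sqrt D))) \<le> \<Phi> (M + n) H" .
  qed (use D False in auto)
  also have "\<dots> = 4 * sqrt (real D) * ((real M + 3) / (real (M + n) + 3)) powr b"
  proof -
    have "real m * x / (real m / 2 * (y * (1 / (2 * sqrt D)))) = 4 * sqrt D * (x / y)" if "0 < y" for x y
      using False D that by simp
    then show ?thesis by (simp add: powr_divide)
  qed
  finally show ?thesis by (simp add: b_def)
qed

section \<open>Vertices of large degree become adjacent\<close>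

text \<open>
  The edge step chooses \<open>u\<close> first and \<open>v\<close> second with probability at least \<open>(D / (2 * T))\<^sup>2\<close>. The
  opposite order would only gain a factor 2.
\<close>

lemma prob_pa_step_not_adjacent_le:
  assumes p: "0 < p" "p < 1" and t: "t \<ge> 1" "G \<in> set_pmf (pa_graph p t)"
    and uv: "u \<in> verts G" "v \<in> verts G" "D \<le> deg G u" "D \<le> deg G v" and T: "t \<le> T"
  shows "measure_pmf.prob (pa_step p G) {H. Upair u v \<notin># edges H}
    \<le> exp (- ((1 - p) * (real D / (2 * real T))\<^sup>2))"
proof -
  let ?N = "{H. Upair u v \<notin># edges H}"
  define \<delta> where "\<delta> = (real D / (2 * real T))\<^sup>2"
  have "\<delta> = (real D / (2 * real T)) * (real D / (2 * real T))"
    by (simp add: \<delta>_def power2_eq_square)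
  also have "\<dots> \<le> pmf (pick_vertex G) u * pmf (pick_vertex G) v"
    unfolding pmf_pick_vertex_pa_graph[OF t uv(1)] pmf_pick_vertex_pa_graph[OF t uv(2)]
    using uv T t(1) by (intro mult_mono frac_le) auto
  finally have \<delta>: "\<delta> \<le> pmf (pair_pmf (pick_vertex G) (pick_vertex G)) (u, v)"
    by (simp add: pmf_pair)
  have \<delta>1: "\<delta> \<le> 1" by (rule order_trans[OF \<delta> pmf_le_1])
  have "measure_pmf.prob (edge_step G) ?N
      \<le> measure_pmf.prob (pair_pmf (pick_vertex G) (pick_vertex G)) (UNIV - {(u, v)})"
    unfolding edge_step_def measure_map_pmf
    by (intro measure_pmf.finite_measure_mono) (auto simp: add_edge_def)
  also have "\<dots> = 1 - pmf (pair_pmf (pick_vertex G) (pick_vertex G)) (u, v)"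
    using measure_pmf.prob_compl[of "{(u, v)}" "pair_pmf (pick_vertex G) (pick_vertex G)"]
    by (simp add: measure_pmf_single)
  finally have E: "measure_pmf.prob (edge_step G) ?N \<le> 1 - \<delta>" using \<delta> by simp
  have "(\<integral>\<^sup>+H. indicator ?N H \<partial>measure_pmf (pa_step p G)) \<le> ennreal (p * 1 + (1 - p) * (1 - \<delta>))"
    by (rule nn_integral_pa_step[OF p])
       (use E \<delta>1 in \<open>auto simp: measure_pmf.emeasure_eq_measure intro!: ennreal_leI\<close>)
  then have "measure_pmf.prob (pa_step p G) ?N \<le> p * 1 + (1 - p) * (1 - \<delta>)"
    using p \<delta>1 by (simp add: measure_pmf.emeasure_eq_measure del: ennreal_plus)
  also have "\<dots> = 1 + - ((1 - p) * \<delta>)" by (simp add: algebra_simps)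
  also have "\<dots> \<le> exp (- ((1 - p) * \<delta>))" by (rule exp_ge_add_one_self)
  finally show ?thesis by (simp add: \<delta>_def)
qed

lemma prob_not_adjacent_le:
  assumes p: "0 < p" "p < 1" and t: "t \<ge> 1" "G \<in> set_pmf (pa_graph p t)"
    and uv: "u \<in> verts G" "v \<in> verts G" "D \<le> deg G u" "D \<le> deg G v"
  shows "measure_pmf.prob (pa_from p n G) {H. Upair u v \<notin># edges H}
    \<le> exp (- ((1 - p) * (real D / (2 * real (t + n)))\<^sup>2 * real n))"
proof -
  let ?N = "{H. Upair u v \<notin># edges H}"
  define \<beta> where "\<beta> = (1 - p) * (real D / (2 * real (t + n)))\<^sup>2"
  define \<Phi> where "\<Phi> s H = exp (\<beta> * real s) * indicator ?N H" for s and H :: mgraph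
  have "(\<integral>\<^sup>+H. ennreal (\<Phi> (t + n) H) \<partial>measure_pmf (pa_from p n G)) \<le> ennreal (\<Phi> t G)"
  proof (rule pa_from_supermartingale[OF t])
    fix s H
    assume s: "t \<le> s" "s < t + n" "H \<in> set_pmf (pa_graph p s)" "subgraph G H"
    have s1: "s \<ge> 1" using s(1) t(1) by simp
    have int: "(\<integral>\<^sup>+K. ennreal (\<Phi> (Suc s) K) \<partial>measure_pmf (pa_step p H))
        = ennreal (exp (\<beta> * real (Suc s)) * measure_pmf.prob (pa_step p H) ?N)"
      by (simp add: \<Phi>_def ennreal_mult ennreal_indicator nn_integral_cmult measure_pmf.emeasure_eq_measure
          del: of_nat_Suc)
    \<comment> \<open>Once adjacent, always adjacent: the potential is zero for ever.\<close>
    show "(\<integral>\<^sup>+K. ennreal (\<Phi> (Suc s) K) \<partial>measure_pmf (pa_step p H)) \<le> ennreal (\<Phi> s H)"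
    proof (cases "H \<in> ?N")
      case True
      have "u \<in> verts H" "v \<in> verts H"
        using s(4) uv(1,2) by (auto simp: subgraph_def verts_def)
      moreover have "D \<le> deg H u" "D \<le> deg H v"
        using deg_mono[OF s(4)] uv(3,4) order_trans by blast+
      ultimately have "measure_pmf.prob (pa_step p H) ?N \<le> exp (- \<beta>)"
        using prob_pa_step_not_adjacent_le[OF p s1 s(3), of u v D "t + n"] s(2)
        by (simp only: \<beta>_def)
      then have "exp (\<beta> * real (Suc s)) * measure_pmf.prob (pa_step p H) ?N
          \<le> exp (\<beta> * real (Suc s)) * exp (- \<beta>)"
        by (intro mult_left_mono) auto
      also have "\<dots> = \<Phi> s H"
        using True by (simp add: \<Phi>_def algebra_simps flip: exp_add)
      finally show ?thesis unfolding int by (rule ennreal_leI)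
    next
      case False
      then have "set_pmf (pa_step p H) \<inter> ?N = {}"
        using subgraph_pa_step[OF s1 s(3)] by (auto simp: subgraph_def dest: mset_subset_eqD)
      then have "measure_pmf.prob (pa_step p H) ?N = 0"
        by (simp add: measure_pmf_zero_iff)
      then show ?thesis unfolding int by simp
    qed
  qed
  also have "\<Phi> t G \<le> exp (\<beta> * real t)"
    by (simp add: \<Phi>_def indicator_def)
  finally have "(\<integral>\<^sup>+H. ennreal (\<Phi> (t + n) H) \<partial>measure_pmf (pa_from p n G)) \<le> ennreal (exp (\<beta> * real t))"
    by (simp add: ennreal_leI)
  then have "measure_pmf.prob (pa_from p n G) ?N \<le> exp (\<beta> * real t) / exp (\<beta> * real (t + n))"
    by (rule prob_pmf_Markov[rotated 2]) (auto simp: \<Phi>_def)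
  also have "\<dots> = exp (- (\<beta> * real n))"
    by (simp add: algebra_simps flip: exp_diff)
  finally show ?thesis by (simp add: \<beta>_def)
qed

lemma card_le_clique_number:
  assumes "is_clique G S"
  shows "card S \<le> clique_number G"
proof -
  have "{S. is_clique G S} \<subseteq> Pow (verts G)" by (auto simp: is_clique_def)
  then have "finite {S. is_clique G S}"
    by (rule finite_subset) (simp add: verts_def)
  then show ?thesis
    unfolding clique_number_def using assms
    by (intro Max_ge) (auto simp: setcompr_eq_image)
qed

text \<open>
  A union bound over the pairs in \<open>S\<close>: unless one of them is missed, \<open>S\<close> itself becomes a clique.
\<close>

lemma prob_clique_number_less_le:
  assumes p: "0 < p" "p < 1" and t: "t \<ge> 1" "G \<in> set_pmf (pa_graph p t)"
    and S: "S \<subseteq> verts G" "\<And>u. u \<in> S \<Longrightarrow> D \<le> deg G u"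
  shows "measure_pmf.prob (pa_from p n G) {H. clique_number H < card S}
    \<le> (real (card S))\<^sup>2 * exp (- ((1 - p) * (real D / (2 * real (t + n)))\<^sup>2 * real n))"
proof -
  have fin: "finite S" using S(1) finite_subset by (auto simp: verts_def)
  let ?N = "\<lambda>(u, v). {H. Upair u v \<notin># edges H}"
  have "measure_pmf.prob (pa_from p n G) {H. clique_number H < card S}
      \<le> measure_pmf.prob (pa_from p n G) (\<Union>e\<in>S \<times> S. ?N e)"
  proof (rule measure_pmf.finite_measure_mono_AE)
    show "AE H in measure_pmf (pa_from p n G). H \<in> {H. clique_number H < card S} \<longrightarrow> H \<in> (\<Union>e\<in>S \<times> S. ?N e)"
      unfolding AE_measure_pmf_iff
    proof (intro ballI impI, rule ccontr)
      fix H assume H: "H \<in> set_pmf (pa_from p n G)" "H \<in> {H. clique_number H < card S}"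
        "H \<notin> (\<Union>e\<in>S \<times> S. ?N e)"
      have "S \<subseteq> verts H"
        using set_pa_from(2)[OF t H(1)] S(1) by (auto simp: subgraph_def verts_def)
      then have "is_clique H S" using H(3) by (auto simp: is_clique_def)
      then show False using card_le_clique_number[of H S] H(2) by simp
    qed
  qed simp
  also have "\<dots> \<le> (\<Sum>e\<in>S \<times> S. measure_pmf.prob (pa_from p n G) (?N e))"
    using fin by (intro measure_pmf.finite_measure_subadditive_finite) auto
  also have "\<dots> \<le> (\<Sum>e\<in>S \<times> S. exp (- ((1 - p) * (real D / (2 * real (t + n)))\<^sup>2 * real n)))"
  proof (rule sum_mono, clarify)
    fix u v assume "u \<in> S" "v \<in> S"
    then show "measure_pmf.prob (pa_from p n G) {H. Upair u v \<notin># edges H}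
        \<le> exp (- ((1 - p) * (real D / (2 * real (t + n)))\<^sup>2 * real n))"
      using S by (intro prob_not_adjacent_le[OF p t]) auto
  qed
  finally show ?thesis by (simp add: card_cartesian_product power2_eq_square)
qed

section \<open>The clique number at time \<open>2t\<close>\<close>

text \<open>
  The three summands are the failure probabilities of the three stages: too few vertices at
  time \<open>M\<close>, too many vertices of small degree at time \<open>t\<close>, and a missing pair at time \<open>2 * t\<close>.
\<close>

lemma prob_pa_graph_clique_number_less_le:
  assumes p: "0 < p" "p < 1" and M: "M \<ge> 1" "M \<le> t" and D: "D \<ge> 2"
  shows "measure_pmf.prob (pa_graph p (2 * t)) {H. 2 * clique_number H < m}
    \<le> 2 ^ m * exp (- p / 2 * (real M - 1))
     + 4 * sqrt (real D) * ((real M + 3) / (real t + 3)) powr ((2 - p) / 4)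
     + (real m)\<^sup>2 * exp (- ((1 - p) * (real D / (4 * real t))\<^sup>2 * real t))"
proof -
  let ?bad = "\<lambda>H. {u\<in>{..<m}. deg H u < D}"
  let ?B = "{H. \<not> (m \<le> nverts H \<and> 2 * card (?bad H) \<le> m)}"
  let ?e2 = "4 * sqrt (real D) * ((real M + 3) / (real t + 3)) powr ((2 - p) / 4)"
  let ?e3 = "(real m)\<^sup>2 * exp (- ((1 - p) * (real D / (4 * real t))\<^sup>2 * real t))"
  have t: "t \<ge> 1" using M by simp
  have "measure_pmf.prob (pa_graph p t) ?B \<le> measure_pmf.prob (pa_graph p M) {G. nverts G < m} + ?e2"
  proof -
    have eq: "pa_graph p t = bind_pmf (pa_graph p M) (pa_from p (t - M))"
      using pa_graph_add[OF M(1), of p "t - M"] M(2) by simp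
    have le: "measure_pmf.prob (pa_from p (t - M) G) ?B \<le> ?e2"
      if G: "G \<in> set_pmf (pa_graph p M)" "G \<notin> {G. nverts G < m}" for G
    proof -
      have "measure_pmf.prob (pa_from p (t - M) G) ?B
          \<le> measure_pmf.prob (pa_from p (t - M) G) {H. m < 2 * card (?bad H)}"
      proof (rule measure_pmf.finite_measure_mono_AE)
        have "m \<le> nverts H" if "H \<in> set_pmf (pa_from p (t - M) G)" for H
          using G(2) set_pa_from(2)[OF M(1) G(1) that] by (simp add: subgraph_def)
        then show "AE H in measure_pmf (pa_from p (t - M) G). H \<in> ?B \<longrightarrow> H \<in> {H. m < 2 * card (?bad H)}"
          by (auto simp: AE_measure_pmf_iff)
      qed simp
      also have "\<dots> \<le> ?e2"
        using prob_many_small_degrees_le[OF p M(1) G(1) _ D, of m "t - M"] G(2) M(2) by simp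
      finally show ?thesis .
    qed
    show ?thesis
      unfolding eq by (rule prob_bind_pmf_le[OF _ le]) simp_all
  qed
  moreover have "measure_pmf.prob (pa_graph p (2 * t)) {H. 2 * clique_number H < m}
      \<le> measure_pmf.prob (pa_graph p t) ?B + ?e3"
  proof -
    have eq: "pa_graph p (2 * t) = bind_pmf (pa_graph p t) (pa_from p t)"
      using pa_graph_add[OF t, of p t] by (simp add: mult_2)
    have le: "measure_pmf.prob (pa_from p t G) {H. 2 * clique_number H < m} \<le> ?e3"
      if G: "G \<in> set_pmf (pa_graph p t)" "G \<notin> ?B" for G
    proof -
      define S where "S = {..<m} - ?bad G"
      have "card S = m - card (?bad G)"
        unfolding S_def by (subst card_Diff_subset) auto
      with G(2) have S: "m \<le> 2 * card S" "card S \<le> m" by auto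
      have "measure_pmf.prob (pa_from p t G) {H. 2 * clique_number H < m}
          \<le> measure_pmf.prob (pa_from p t G) {H. clique_number H < card S}"
        using S by (intro measure_pmf.finite_measure_mono) auto
      also have "\<dots> \<le> (real (card S))\<^sup>2 * exp (- ((1 - p) * (real D / (2 * real (t + t)))\<^sup>2 * real t))"
        using G(2) by (intro prob_clique_number_less_le[OF p t G(1)]) (auto simp: S_def verts_def)
      also have "real (t + t) = 2 * real t" by simp
      also have "(real (card S))\<^sup>2 * exp (- ((1 - p) * (real D / (2 * (2 * real t)))\<^sup>2 * real t)) \<le> ?e3"
        using S(2) by (simp add: power_mono)
      finally show ?thesis .
    qed
    show ?thesis
      unfolding eq by (rule prob_bind_pmf_le[OF _ le]) simp_all
  qed
  ultimately show ?thesis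
    using prob_few_verts_le[OF p M(1), of m] by linarith
qed

text \<open>
  The choice of \<open>N\<close> makes \<open>(t / N) powr (1 - p / 2) = sqrt (t * ln t)\<close>. This is the order of the
  degree that a vertex born around time \<open>N\<close> has at time \<open>t\<close>, and also, up to a constant, the
  degree \<open>D\<close> that the union bound needs. Taking \<open>M\<close> smaller than \<open>N\<close> by the factor \<open>F\<close> raises the typical
  degrees above \<open>D\<close> by a power of \<open>F\<close>, which is where the term in \<open>F\<close> of the error comes from.
\<close>

lemma prob_pa_graph_clique_number_ge:
  fixes p F :: real and t :: nat
  defines "N \<equiv> real t powr ((1 - p) / (2 - p)) / ln (real t) powr (1 / (2 - p))"
  assumes p: "0 < p" "p < 1" and F: "1 \<le> F" and L: "1 \<le> ln (real t)" and x: "10 / p \<le> N / F"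
  shows "1 - (exp 2 * exp (- p / 4 * (N / F))
      + 8 * (192 / (1 - p)) powr (1 / 4) * F powr (- (2 - p) / 4) + 1 / real t)
    \<le> measure_pmf.prob (pa_graph p (2 * t)) {G. p / 16 * (N / F) \<le> real (clique_number G)}"
proof -
  define L where "L = ln (real t)"
  define x where "x = N / F"
  define M where "M = nat \<lfloor>x\<rfloor>"
  define m where "m = nat \<lfloor>p * M / 4\<rfloor>"
  \<comment> \<open>The constant 48 gives the exponent \<open>3 * ln t\<close>: a pair is missed with probability at most
    \<open>1 / t ^ 3\<close>, and there are at most \<open>t\<^sup>2\<close> pairs.\<close>
  define y where "y = sqrt (48 / (1 - p) * (real t * L))"
  define D where "D = nat \<lceil>y\<rceil>"
  have L1: "1 \<le> L" using L by (simp add: L_def)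
  have t1: "1 \<le> t" using L by (cases "t = 0") auto
  have N: "0 \<le> N" "N \<le> real t"
  proof -
    show "0 \<le> N" by (simp add: N_def)
    have "N \<le> real t powr 1 / 1"
      unfolding N_def using p L t1
      by (intro frac_le powr_mono ge_one_powr_ge_zero) auto
    then show "N \<le> real t" using t1 by simp
  qed
  have "10 / 1 \<le> 10 / p" using p by (intro divide_left_mono) auto
  then have x10: "10 \<le> x" "10 / p \<le> x" using x by (auto simp: x_def)
  have "x \<le> N / 1" unfolding x_def using F N by (intro divide_left_mono) auto
  then have xt: "x \<le> real t" using N by simp
  have M: "x - 1 \<le> real M" "real M \<le> x" "1 \<le> M"
    using x10 by (auto simp: M_def) linarith+
  have Mt: "M \<le> t" using M xt by linarith
  have "0 \<le> p * M / 4" using p by simp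
  then have m: "p * M / 4 - 1 \<le> real m" "real m \<le> p * M / 4"
    unfolding m_def by linarith+
  have "p * M \<le> 1 * real M" using p by (intro mult_right_mono) auto
  then have mt: "real m \<le> real t" using m(2) Mt by linarith
  have "48 * 1 \<le> 48 / (1 - p) * (real t * L)"
  proof (intro mult_mono)
    show "48 \<le> 48 / (1 - p)" using p by (simp add: field_simps)
    show "1 \<le> real t * L" using mult_mono[of 1 "real t" 1 L] t1 L1 by simp
  qed (use p in auto)
  then have y48: "48 \<le> y\<^sup>2" by (simp add: y_def)
  have y0: "0 \<le> y" using p L1 by (simp add: y_def)
  have y2: "2 \<le> y"
    by (rule power2_le_imp_le) (use y48 y0 in auto)
  have D: "y \<le> real D" "real D \<le> 2 * y" "2 \<le> D"
    using y2 by (auto simp: D_def) linarith+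
  have x4: "p * x / 16 \<le> real m / 2"
  proof -
    have "p * (x - 1) \<le> p * M" using p M by (intro mult_left_mono) auto
    moreover have "10 \<le> p * x" using x10(2) p by (simp add: field_simps)
    ultimately show ?thesis using m(1) p by (simp add: algebra_simps)
  qed

  have e1: "2 ^ m * exp (- p / 2 * (real M - 1)) \<le> exp 2 * exp (- p / 4 * x)"
  proof -
    have "(2::real) ^ m \<le> exp 1 ^ m"
      using exp_ge_add_one_self[of 1] by (intro power_mono) auto
    then have "2 ^ m * exp (- p / 2 * (real M - 1)) \<le> exp (real m) * exp (- p / 2 * (real M - 1))"
      by (intro mult_right_mono) (auto simp flip: exp_of_nat_mult)
    also have "\<dots> = exp (real m - p / 2 * (real M - 1))"
      by (simp flip: exp_add)
    also have "\<dots> \<le> exp (2 - p / 4 * x)"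
    proof -
      have "p * (x - 1) \<le> p * M" using p M by (intro mult_left_mono) auto
      then show ?thesis using m(2) p by (simp add: field_simps)
    qed
    finally show ?thesis by (simp flip: exp_add)
  qed

  have e2: "4 * sqrt (real D) * ((real M + 3) / (real t + 3)) powr ((2 - p) / 4)
      \<le> 8 * (192 / (1 - p)) powr (1 / 4) * F powr (- (2 - p) / 4)"
  proof -
    have tL: "0 < real t * L" using t1 L1 by simp
    have "sqrt (real D) \<le> sqrt (2 * y)" using D by simp
    also have "2 * y = sqrt (192 / (1 - p) * (real t * L))"
      unfolding y_def by (rule real_sqrt_unique[symmetric]) (use p tL in \<open>auto simp: power_mult_distrib\<close>)
    also have "sqrt \<dots> = (192 / (1 - p) * (real t * L)) powr (1 / 4)"
      using p tL by (simp add: powr_powr flip: powr_half_sqrt)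
    also have "\<dots> = (192 / (1 - p)) powr (1 / 4) * (real t * L) powr (1 / 4)"
      using p tL by (subst powr_mult) auto
    finally have s: "sqrt (real D) \<le> (192 / (1 - p)) powr (1 / 4) * (real t * L) powr (1 / 4)" .
    have "(real M + 3) / (real t + 3) \<le> (4 * x) / real t"
      using M x10 t1 by (intro frac_le) auto
    also have "\<dots> = 4 * ((N / real t) / F)" by (simp add: x_def)
    also have "N / real t = (real t * L) powr (- 1 / (2 - p))"
    proof -
      have "real t = real t powr 1" using t1 by simp
      then have "N / real t = real t powr ((1 - p) / (2 - p) - 1) / L powr (1 / (2 - p))"
        by (simp add: N_def L_def powr_diff)
      also have "(1 - p) / (2 - p) - 1 = - 1 / (2 - p)"
        using p by (simp add: field_simps)
      finally show ?thesis
        using t1 L1 by (simp add: powr_mult powr_minus_divide)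
    qed
    finally have "((real M + 3) / (real t + 3)) powr ((2 - p) / 4)
        \<le> (4 * ((real t * L) powr (- 1 / (2 - p)) / F)) powr ((2 - p) / 4)"
      using p by (intro powr_mono2) auto
    also have "\<dots> = 4 powr ((2 - p) / 4) * ((real t * L) powr (- 1 / 4) * F powr (- (2 - p) / 4))"
    proof -
      have "- 1 / (2 - p) * ((2 - p) / 4) = - 1 / 4" using p by (simp add: field_simps)
      then have "((real t * L) powr (- 1 / (2 - p))) powr ((2 - p) / 4) = (real t * L) powr (- 1 / 4)"
        by (simp only: powr_powr)
      moreover have "(1 / F) powr ((2 - p) / 4) = F powr (- (2 - p) / 4)"
        using F powr_minus_divide[of F "(2 - p) / 4"] by (simp add: powr_divide minus_divide_left)
      ultimately show ?thesis
        using F tL powr_mult[of "(real t * L) powr (- 1 / (2 - p))" "1 / F" "(2 - p) / 4"]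
        by (subst powr_mult) auto
    qed
    also have "\<dots> \<le> 2 * ((real t * L) powr (- 1 / 4) * F powr (- (2 - p) / 4))"
    proof (intro mult_right_mono)
      have "4 powr ((2 - p) / 4) \<le> (4::real) powr (1 / 2)"
        using p by (intro powr_mono) auto
      also have "\<dots> = 2" by (simp add: powr_half_sqrt)
      finally show "4 powr ((2 - p) / 4) \<le> (2::real)" .
    qed auto
    finally have r: "((real M + 3) / (real t + 3)) powr ((2 - p) / 4)
        \<le> 2 * ((real t * L) powr (- 1 / 4) * F powr (- (2 - p) / 4))" .
    have "sqrt (real D) * ((real M + 3) / (real t + 3)) powr ((2 - p) / 4)
        \<le> ((192 / (1 - p)) powr (1 / 4) * (real t * L) powr (1 / 4))
           * (2 * ((real t * L) powr (- 1 / 4) * F powr (- (2 - p) / 4)))"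
      by (intro mult_mono s r) auto
    also have "\<dots> = 2 * (192 / (1 - p)) powr (1 / 4) * F powr (- (2 - p) / 4)
        * ((real t * L) powr (1 / 4) * (real t * L) powr (- 1 / 4))"
      by (simp only: mult_ac)
    also have "(real t * L) powr (1 / 4) * (real t * L) powr (- 1 / 4) = 1"
      using tL t1 L1 by (simp flip: powr_add)
    finally show ?thesis by (simp add: mult_ac)
  qed

  have e3: "(real m)\<^sup>2 * exp (- ((1 - p) * (real D / (4 * real t))\<^sup>2 * real t)) \<le> 1 / real t"
  proof -
    have "3 * L = (1 - p) * (y / (4 * real t))\<^sup>2 * real t"
    proof -
      have "y\<^sup>2 = 48 / (1 - p) * (real t * L)"
        unfolding y_def using p L1 by simp
      then show ?thesis
        using p t1 by (simp add: power_divide) (simp add: field_simps power2_eq_square)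
    qed
    also have "\<dots> \<le> (1 - p) * (real D / (4 * real t))\<^sup>2 * real t"
      using p D(1) y0 by (intro mult_right_mono mult_left_mono power_mono divide_right_mono) auto
    finally have "exp (- ((1 - p) * (real D / (4 * real t))\<^sup>2 * real t)) \<le> exp (- (3 * L))"
      by simp
    also have "\<dots> = 1 / (real t) ^ 3"
      using t1 exp_of_nat_mult[of 3 L] by (simp add: L_def exp_minus inverse_eq_divide)
    finally have "(real m)\<^sup>2 * exp (- ((1 - p) * (real D / (4 * real t))\<^sup>2 * real t))
        \<le> (real t)\<^sup>2 * (1 / (real t) ^ 3)"
      using mt by (intro mult_mono power_mono) auto
    also have "\<dots> = 1 / real t"
      using t1 by (simp add: power2_eq_square power3_eq_cube)
    finally show ?thesis .
  qed

  let ?Q = "measure_pmf (pa_graph p (2 * t))"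
  have "1 - measure ?Q {G. 2 * clique_number G < m} = measure ?Q (space ?Q - {G. 2 * clique_number G < m})"
    by (rule measure_pmf.prob_compl[symmetric]) simp
  also have "\<dots> \<le> measure ?Q {G. p / 16 * x \<le> real (clique_number G)}"
    using x4 by (intro measure_pmf.finite_measure_mono) auto
  finally have "1 - measure ?Q {G. 2 * clique_number G < m} \<le> \<dots>" .
  moreover note prob_pa_graph_clique_number_less_le[OF p M(3) Mt D(3), of m] e1 e2 e3
  ultimately show ?thesis unfolding x_def[symmetric] by linarith
qed

theorem theorem1p1:
  fixes p :: real and f :: "nat \<Rightarrow> nat"
  assumes "0 < p" and "p < 1"
    and "\<And>t. t \<ge> 1 \<Longrightarrow> f t \<ge> 1"
    and "filterlim f at_top at_top"
  shows "\<exists>c>0. (\<lambda>t. measure_pmf.prob (pa_graph p (2 * t))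
           {G. real (clique_number G) \<ge>
                 c * (real t powr ((1 - p) / (2 - p)) /
                      (ln (real t) powr (1 / (2 - p)) * real (f t)))})
         \<longlonglongrightarrow> 1"
proof (intro exI conjI)
  show "0 < p / 16" using assms by simp
  define N where "N t = real t powr ((1 - p) / (2 - p)) / ln (real t) powr (1 / (2 - p))" for t :: nat
  \<comment> \<open>The function \<open>f\<close> may outgrow every power of \<open>t\<close>, and \<open>N / f\<close> need not tend to infinity.
    Truncating at \<open>ln t\<close> repairs this and makes the claimed bound only stronger.\<close>
  define F where "F t = min (real (f t)) (ln (real t))" for t
  have ln_lim: "filterlim (\<lambda>t. ln (real t)) at_top sequentially" by real_asymp
  have f_lim: "filterlim (\<lambda>t. real (f t)) at_top sequentially"
    using filterlim_compose[OF filterlim_real_sequentially assms(4)] .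
  have F_lim: "filterlim F at_top sequentially"
    unfolding F_def filterlim_at_top min.bounded_iff
    using ln_lim f_lim by (auto simp: filterlim_at_top intro: eventually_conj)
  have "filterlim (\<lambda>t. N t / ln (real t)) at_top sequentially"
  proof -
    have "0 < (1 - p) / (2 - p)" using assms by simp
    then have "filterlim (\<lambda>t::nat. real t powr ((1 - p) / (2 - p)) / ln (real t) powr b / ln (real t)) at_top sequentially" for b
      by real_asymp
    then show ?thesis by (simp add: N_def)
  qed
  moreover have "eventually (\<lambda>t. N t / ln (real t) \<le> N t / F t) sequentially"
    using filterlim_at_top[THEN iffD1, OF F_lim, rule_format, of 1]
    by eventually_elim (auto simp: F_def N_def intro!: divide_left_mono)
  ultimately have x_lim: "filterlim (\<lambda>t. N t / F t) at_top sequentially"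
    by (rule filterlim_at_top_mono)

  let ?err = "\<lambda>t. exp 2 * exp (- p / 4 * (N t / F t))
      + 8 * (192 / (1 - p)) powr (1 / 4) * F t powr (- (2 - p) / 4) + 1 / real t"
  have "?err \<longlonglongrightarrow> exp 2 * 0 + 8 * (192 / (1 - p)) powr (1 / 4) * 0 + 0"
  proof (intro tendsto_add tendsto_mult tendsto_const)
    have "filterlim (\<lambda>x. exp (- p / 4 * x)) (nhds 0) at_top"
      using assms by real_asymp
    then show "(\<lambda>t. exp (- p / 4 * (N t / F t))) \<longlonglongrightarrow> 0"
      by (rule filterlim_compose[OF _ x_lim])
    have "filterlim (\<lambda>x. x powr (- (2 - p) / 4)) (nhds 0) at_top"
      using assms by (intro tendsto_neg_powr filterlim_ident) auto
    then show "(\<lambda>t. F t powr (- (2 - p) / 4)) \<longlonglongrightarrow> 0"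
      by (rule filterlim_compose[OF _ F_lim])
    show "(\<lambda>t. 1 / real t) \<longlonglongrightarrow> 0" by real_asymp
  qed
  then have "(\<lambda>t. 1 - ?err t) \<longlonglongrightarrow> 1 - 0"
    by (intro tendsto_diff tendsto_const) simp
  then have lower: "(\<lambda>t. 1 - ?err t) \<longlonglongrightarrow> 1"
    by simp
  show "(\<lambda>t. measure_pmf.prob (pa_graph p (2 * t))
           {G. real (clique_number G) \<ge>
                 p / 16 * (real t powr ((1 - p) / (2 - p)) /
                      (ln (real t) powr (1 / (2 - p)) * real (f t)))}) \<longlonglongrightarrow> 1"
    (is "?P \<longlonglongrightarrow> 1")
  proof (rule tendsto_sandwich[of "\<lambda>t. 1 - ?err t" _ _ "\<lambda>_. 1"])
    show "eventually (\<lambda>t. 1 - ?err t \<le> ?P t) sequentially"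
      using filterlim_at_top[THEN iffD1, OF F_lim, rule_format, of 1]
        filterlim_at_top[THEN iffD1, OF x_lim, rule_format, of "10 / p"]
    proof eventually_elim
      case (elim t)
      then have F1: "1 \<le> ln (real t)" "1 \<le> real (f t)" by (auto simp: F_def)
      have "N t / real (f t) \<le> N t / F t"
        using elim F1 by (intro divide_left_mono) (auto simp: F_def N_def)
      then have le: "p / 16 * (N t / real (f t)) \<le> p / 16 * (N t / F t)"
        using assms by (intro mult_left_mono) auto
      have "1 - ?err t \<le> measure_pmf.prob (pa_graph p (2 * t)) {G. p / 16 * (N t / F t) \<le> real (clique_number G)}"
        using prob_pa_graph_clique_number_ge[OF assms(1,2) elim(1) F1(1)] elim(2)
        by (simp add: N_def)
      also have "\<dots> \<le> measure_pmf.prob (pa_graph p (2 * t)) {G. p / 16 * (N t / real (f t)) \<le> real (clique_number G)}"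
        using le by (intro measure_pmf.finite_measure_mono) auto
      finally show ?case by (simp add: N_def)
    qed
  qed (use lower in simp_all)
qed

end
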